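(* For any $t \in \mathbb{Z}^+$ and any $\alpha,\beta$ with $\alpha \geq 1$ and $\alpha+\beta \geq t$, the algorithm Follow-the-Predictions ($\mathrm{FtP}$) is strictly $(\alpha,\beta,1)$-competitive for $\mathrm{ASG}_t$ with respect to $(\mu_0,\mu_1)$.
   Context: Online $(1,t)$-Asymmetric String Guessing with Unknown History and Predictions ($\mathrm{ASG}_t$), $t\in\mathbb{Z}^+$: an instance is a triple $I=(x,\hat{x},r)$ where $x,\hat x\in\{0,1\}^n$ and $r=\langle r_1,\dots,r_n\rangle$. Each request $r_i$ is a prompt to irrevocably output a bit $y_i$; together with $r_i$ the prediction bit $\hat{x}_i$ is revealed; $x$ is revealed only after the last request. Cost: $\mathrm{Alg}(I)=\sum_{i=1}^n\big(y_i+t\,x_i(1-y_i)\big)$, and $\mathrm{Opt}(I)=\sum_i x_i$. $\mathrm{FtP}$ outputs $y_i=\hat{x}_i$ for every $i$. Error measures: $\mu_0(I)=\sum_{i=1}^n x_i(1-\hat{x}_i)$ and $\mu_1(I)=\sum_{i=1}^n (1-x_i)\hat{x}_i$. Competitiveness: for a pair of error measures $(\eta_0,\eta_1)$, a deterministic online algorithm $\mathrm{Alg}$ for a minimization problem is $(\alpha,\beta,\gamma)$-competitive with respect to $(\eta_0,\eta_1)$ if there is a constant $\kappa$ such that for all instances $I$, $\mathrm{Alg}(I)\le \alpha\,\mathrm{Opt}(I)+\beta\,\eta_0(I)+\gamma\,\eta_1(I)+\kappa$ (here $\alpha,\beta,\gamma$ are nonnegative, possibly instance-dependent, quantities); it is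 strictly $(\alpha,\beta,\gamma)$-competitive if this holds with $\kappa\le 0$. *)

theory Defs
  imports Complex_Main
begin

definition competitive_up_to ::
  "'i set \<Rightarrow> ('i \<Rightarrow> real) \<Rightarrow> ('i \<Rightarrow> real) \<Rightarrow> ('i \<Rightarrow> real) \<times> ('i \<Rightarrow> real) \<Rightarrow>
   ('i \<Rightarrow> real) \<times> ('i \<Rightarrow> real) \<times> ('i \<Rightarrow> real) \<Rightarrow> real \<Rightarrow> bool"
where
  "competitive_up_to insts alg_cost opt_cost =
     (\<lambda>(\<eta>\<^sub>0, \<eta>\<^sub>1) (\<alpha>, \<beta>, \<gamma>) \<kappa>. \<forall>I\<in>insts.
        0 \<le> \<alpha> I \<and> 0 \<le> \<beta> I \<and> 0 \<le> \<gamma> I \<and>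
        alg_cost I \<le> \<alpha> I * opt_cost I + \<beta> I * \<eta>\<^sub>0 I + \<gamma> I * \<eta>\<^sub>1 I + \<kappa>)"

definition competitive ::
  "'i set \<Rightarrow> ('i \<Rightarrow> real) \<Rightarrow> ('i \<Rightarrow> real) \<Rightarrow> ('i \<Rightarrow> real) \<times> ('i \<Rightarrow> real) \<Rightarrow>
   ('i \<Rightarrow> real) \<times> ('i \<Rightarrow> real) \<times> ('i \<Rightarrow> real) \<Rightarrow> bool"
where
  "competitive insts alg_cost opt_cost \<eta> r \<longleftrightarrow>
     (\<exists>\<kappa>. competitive_up_to insts alg_cost opt_cost \<eta> r \<kappa>)"

definition strictly_competitive ::
  "'i set \<Rightarrow> ('i \<Rightarrow> real) \<Rightarrow> ('i \<Rightarrow> real) \<Rightarrow> ('i \<Rightarrow> real) \<times> ('i \<Rightarrow> real) \<Rightarrow>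
   ('i \<Rightarrow> real) \<times> ('i \<Rightarrow> real) \<times> ('i \<Rightarrow> real) \<Rightarrow> bool"
where
  "strictly_competitive insts alg_cost opt_cost \<eta> r \<longleftrightarrow>
     (\<exists>\<kappa>\<le>0. competitive_up_to insts alg_cost opt_cost \<eta> r \<kappa>)"

datatype request = Prompt

text \<open>Instances are triples (x, xh, r): true string, predicted string, request sequence.
  Bits are Booleans, turned into numbers by \<^const>\<open>of_bool\<close>; positions count from 0.\<close>

type_synonym asg_instance = "bool list \<times> bool list \<times> request list"

definition asg_instances :: "asg_instance set" where
  "asg_instances = {(x, xh, r). length xh = length x \<and> length r = length x}"

text \<open>A deterministic online algorithm maps the requests and prediction bits revealed so far
  (the current ones last) to its next output bit. Its own earlier outputs are determined by
  this history, and \<open>x\<close> is not available to it.\<close>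

type_synonym asg_algorithm = "(request \<times> bool) list \<Rightarrow> bool"

definition asg_output :: "asg_algorithm \<Rightarrow> asg_instance \<Rightarrow> bool list" where
  "asg_output A = (\<lambda>(x, xh, r). map (\<lambda>i. A (take (Suc i) (zip r xh))) [0..<length r])"

definition asg_cost :: "nat \<Rightarrow> asg_algorithm \<Rightarrow> asg_instance \<Rightarrow> real" where
  "asg_cost t A = (\<lambda>(x, xh, r). let y = asg_output A (x, xh, r) in
     \<Sum>i<length x. of_bool (y ! i) + real t * of_bool (x ! i) * (1 - of_bool (y ! i)))"

definition asg_opt :: "asg_instance \<Rightarrow> real" where
  "asg_opt = (\<lambda>(x, xh, r). \<Sum>i<length x. of_bool (x ! i))"

definition mu0 :: "asg_instance \<Rightarrow> real" (\<open>\<mu>\<^sub>0\<close>) where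
  "\<mu>\<^sub>0 = (\<lambda>(x, xh, r). \<Sum>i<length x. of_bool (x ! i) * (1 - of_bool (xh ! i)))"

definition mu1 :: "asg_instance \<Rightarrow> real" (\<open>\<mu>\<^sub>1\<close>) where
  "\<mu>\<^sub>1 = (\<lambda>(x, xh, r). \<Sum>i<length x. (1 - of_bool (x ! i)) * of_bool (xh ! i))"

definition FtP :: asg_algorithm where
  "FtP h = snd (last h)"

lemma asg_output_FtP:
  assumes "(x, xh, r) \<in> asg_instances"
  shows "asg_output FtP (x, xh, r) = xh"
  using assms
  by (intro nth_equalityI)
     (auto simp: asg_instances_def asg_output_def FtP_def take_Suc_conv_app_nth)

end

theory Submission
  imports Defs
begin

text \<open>Since \<open>FtP\<close> outputs the prediction itself, its cost, the optimum and both
  errors are sums over positions of terms in the true and predicted bit, so four cases decide. For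
  (0,0) both sides vanish; (0,1) costs 1, paid by \<open>mu1\<close>; (1,1) costs 1, covered by
  \<alpha> \<ge> 1; (1,0) costs t, covered by \<alpha> + \<beta> \<ge> t.
  \<open>asg_cost_FtP_le\<close> adds these up on one instance.\<close>

lemma asg_cost_FtP_le:
  fixes a b :: real
  assumes I: "I \<in> asg_instances" and a: "1 \<le> a" and ab: "real t \<le> a + b"
  shows "asg_cost t FtP I \<le> a * asg_opt I + b * \<mu>\<^sub>0 I + \<mu>\<^sub>1 I"
proof -
  obtain x xh r where I_eq: "I = (x, xh, r)"
    by (cases I)
  have out: "asg_output FtP (x, xh, r) = xh"
    using I I_eq by (simp add: asg_output_FtP)
  \<comment> \<open>The bound already holds for each position separately.\<close>
  have "(\<Sum>i<length x. of_bool (xh ! i) + real t * of_bool (x ! i) * (1 - of_bool (xh ! i)))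
    \<le> (\<Sum>i<length x. a * of_bool (x ! i) + b * (of_bool (x ! i) * (1 - of_bool (xh ! i)))
        + (1 - of_bool (x ! i)) * of_bool (xh ! i))"
    using a ab by (intro sum_mono) (auto simp: of_bool_def)
  then show ?thesis
    \<comment> \<open>The weights \<open>a\<close> and \<open>b\<close> do not vary with the
      position, so they can be pulled out of the sums.\<close>
    by (simp only: I_eq asg_cost_def asg_opt_def mu0_def mu1_def out sum.distrib sum_distrib_left
        prod.case Let_def)
qed

theorem theorem9:
  fixes t :: nat and \<alpha> \<beta> :: "asg_instance \<Rightarrow> real"
  assumes "t \<ge> 1"
    and "\<And>I. I \<in> asg_instances \<Longrightarrow> \<alpha> I \<ge> 1"
    and "\<And>I. I \<in> asg_instances \<Longrightarrow> \<beta> I \<ge> 0"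
    and "\<And>I. I \<in> asg_instances \<Longrightarrow> \<alpha> I + \<beta> I \<ge> real t"
  shows "strictly_competitive asg_instances (asg_cost t FtP) asg_opt (\<mu>\<^sub>0, \<mu>\<^sub>1) (\<alpha>, \<beta>, \<lambda>_. 1)"
proof -
  have "0 \<le> \<alpha> I \<and> 0 \<le> \<beta> I \<and>
      asg_cost t FtP I \<le> \<alpha> I * asg_opt I + \<beta> I * \<mu>\<^sub>0 I + \<mu>\<^sub>1 I"
    if "I \<in> asg_instances" for I
    \<comment> \<open>With \<open>I\<close> fixed, the instance-dependent \<alpha> and \<beta>
      become the plain reals \<open>a\<close> and \<open>b\<close> of the lemma.\<close>
    using assms(2-4)[OF that] asg_cost_FtP_le[OF that] by simp
  \<comment> \<open>No additive slack arises at any position, so \<kappa> = 0 witnesses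
    strictness.\<close>
  then have "competitive_up_to asg_instances (asg_cost t FtP) asg_opt (\<mu>\<^sub>0, \<mu>\<^sub>1) (\<alpha>, \<beta>, \<lambda>_. 1) 0"
    unfolding competitive_up_to_def by simp
  then show ?thesis
    unfolding strictly_competitive_def by blast
qed

end
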